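(* Let $G$ be a group and let $L(G)$ be the poset of all subgroups of $G$ of finite index, ordered by inclusion. Then $L(G)$ is a lattice. Furthermore, if $G$ is finitely generated, then for every $H\in L(G)$ the principal dual order ideal $V_H = \{K\leq G : H\leq K\}$ is finite, so $L(G)$ is a locally finite lattice.
   Context: A lattice is a poset in which every pair of elements has a least upper bound (join) and a greatest lower bound (meet). A poset $P$ is locally finite if every closed interval $[s,t] = \{u\in P : s\leq u\leq t\}$ (for $s\leq t$ in $P$) is finite. For an element $t$ of a poset $P$, the principal dual order ideal generated by $t$ is $V_t = \{s\in P : s\geq t\}$. *)

theory Defs
  imports "HOL-Algebra.Complete_Lattice" "HOL-Algebra.Coset" "HOL-Algebra.Generated_Groups"
begin

definition finite_index :: "('a, 'b) monoid_scheme \<Rightarrow> 'a set \<Rightarrow> bool" where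
  "finite_index G H \<longleftrightarrow> finite (rcosets\<^bsub>G\<^esub> H)"

definition finitely_generated_group :: "('a, 'b) monoid_scheme \<Rightarrow> bool" where
  "finitely_generated_group G \<longleftrightarrow>
     (\<exists>S. finite S \<and> S \<subseteq> carrier G \<and> generate G S = carrier G)"

definition finite_index_subgroups :: "('a, 'b) monoid_scheme \<Rightarrow> 'a set gorder" where
  "finite_index_subgroups G =
     \<lparr>carrier = {H. subgroup H G \<and> finite_index G H}, eq = (=), le = (\<subseteq>)\<rparr>"

definition principal_dual_order_ideal :: "('a, 'b) gorder_scheme \<Rightarrow> 'a \<Rightarrow> 'a set" where
  "principal_dual_order_ideal P t = {s \<in> carrier P. t \<sqsubseteq>\<^bsub>P\<^esub> s}"

definition locally_finite :: "('a, 'b) gorder_scheme \<Rightarrow> bool" where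
  "locally_finite P \<longleftrightarrow>
     (\<forall>s \<in> carrier P. \<forall>t \<in> carrier P. s \<sqsubseteq>\<^bsub>P\<^esub> t \<longrightarrow> finite \<lbrace>s..t\<rbrace>\<^bsub>P\<^esub>)"

end

theory Submission
  imports Defs
begin

text \<open>
  Everything rests on the fact that a subgroup \<open>K\<close> containing \<open>H\<close> is a union of right cosets of
  \<open>H\<close>.  This has two consequences when \<open>H\<close> has finite index.  The cosets of \<open>K\<close> arise from those of
  \<open>H\<close> by enlarging them, so \<open>K\<close> has finite index as well
  (\<open>finite_index_supergroup\<close>); and \<open>K\<close> is determined by the set of cosets of \<open>H\<close> that it contains,
  so only finitely many such \<open>K\<close> exist (\<open>finite_supergroups\<close>).

  For the lattice structure, the meet of \<open>H\<close> and \<open>K\<close> is \<open>H \<inter> K\<close>, which has finite index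
  because each of its cosets is the intersection of a coset of \<open>H\<close> and a coset of \<open>K\<close>
  (\<open>finite_index_Int\<close>).  The join is the subgroup generated by \<open>H \<union> K\<close>; it has finite index since it
  contains \<open>H\<close>.  Local finiteness follows because an interval \<open>[H, K]\<close> is a part of the
  principal dual order ideal of \<open>H\<close>.
\<close>

lemma (in group) finite_index_Int:
  assumes H: "subgroup H G" "finite_index G H" and K: "subgroup K G" "finite_index G K"
  shows "finite_index G (H \<inter> K)"
proof -
  have coset: "(H \<inter> K) #> x = (H #> x) \<inter> (K #> x)" if "x \<in> carrier G" for x
  proof
    show "(H #> x) \<inter> (K #> x) \<subseteq> (H \<inter> K) #> x"
    proof
      fix y assume "y \<in> (H #> x) \<inter> (K #> x)"
      then obtain h k where hk: "h \<in> H" "k \<in> K" "y = h \<otimes> x" "h \<otimes> x = k \<otimes> x"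
        unfolding r_coset_def by auto
      then have "h = k"
        using subgroup.mem_carrier[OF H(1)] subgroup.mem_carrier[OF K(1)] that
        by (metis right_cancel)
      then show "y \<in> (H \<inter> K) #> x"
        using hk unfolding r_coset_def by auto
    qed
  qed (auto simp: r_coset_def)
  have "rcosets (H \<inter> K) \<subseteq> (\<lambda>(A, B). A \<inter> B) ` ((rcosets H) \<times> (rcosets K))"
    unfolding RCOSETS_def by (auto simp: coset)
  moreover have "finite ((rcosets H) \<times> (rcosets K))"
    using H K by (simp add: finite_index_def)
  ultimately show ?thesis
    unfolding finite_index_def by (meson finite_surj)
qed

text \<open>A coset of \<open>K\<close> is recovered from any coset of \<open>H\<close> inside it by multiplying with \<open>K\<close> on the
  left, because \<open>K H = K\<close>.\<close>

lemma (in group) finite_index_supergroup: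
  assumes H: "subgroup H G" "finite_index G H" and K: "subgroup K G" and "H \<subseteq> K"
  shows "finite_index G K"
proof -
  have "K <#> H = K"
  proof
    show "K <#> H \<subseteq> K"
      using \<open>H \<subseteq> K\<close> subgroup.m_closed[OF K] by (auto simp: set_mult_def)
    have "x = x \<otimes> \<one>" if "x \<in> K" for x
      using that subgroup.mem_carrier[OF K] by simp
    then show "K \<subseteq> K <#> H"
      using subgroup.one_closed[OF H(1)] unfolding set_mult_def by blast
  qed
  then have "K #> x = K <#> (H #> x)" if "x \<in> carrier G" for x
    using setmult_rcos_assoc[OF subgroup.subset[OF K] subgroup.subset[OF H(1)] that] by simp
  then have "rcosets K \<subseteq> (\<lambda>C. K <#> C) ` (rcosets H)"
    unfolding RCOSETS_def by auto
  then show ?thesis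
    using H(2) unfolding finite_index_def by (meson finite_surj)
qed

lemma (in group) supergroup_eq_Union_rcosets:
  assumes H: "subgroup H G" and K: "subgroup K G" and "H \<subseteq> K"
  shows "K = \<Union> {C \<in> rcosets H. C \<subseteq> K}"
proof
  show "K \<subseteq> \<Union> {C \<in> rcosets H. C \<subseteq> K}"
  proof
    fix x assume x: "x \<in> K"
    then have xG: "x \<in> carrier G"
      using subgroup.mem_carrier[OF K] by blast
    have "H #> x \<in> rcosets H"
      using rcosetsI subgroup.subset[OF H] xG by blast
    moreover have "x \<in> H #> x"
      using rcos_self[OF xG H] .
    moreover have "H #> x \<subseteq> K"
      using \<open>H \<subseteq> K\<close> x subgroup.m_closed[OF K] by (auto simp: r_coset_def)
    ultimately show "x \<in> \<Union> {C \<in> rcosets H. C \<subseteq> K}"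
      by blast
  qed
qed blast

lemma (in group) finite_supergroups:
  assumes H: "subgroup H G" "finite_index G H"
  shows "finite {K. subgroup K G \<and> H \<subseteq> K}"
proof (rule finite_subset)
  show "{K. subgroup K G \<and> H \<subseteq> K} \<subseteq> Union ` Pow (rcosets H)"
    using supergroup_eq_Union_rcosets[OF H(1)] by blast
  show "finite (Union ` Pow (rcosets H))"
    using H(2) by (simp add: finite_index_def)
qed

lemma (in group) lattice_finite_index_subgroups:
  "lattice (finite_index_subgroups G)"
proof -
  let ?L = "finite_index_subgroups G"
  have po: "partial_order ?L"
    by unfold_locales (auto simp: finite_index_subgroups_def)
  have join: "\<exists>s. least ?L s (Upper ?L {H, K})"
    if H: "H \<in> carrier ?L" and K: "K \<in> carrier ?L" for H K
  proof -
    have sub: "subgroup H G" "subgroup K G" and fin: "finite_index G H"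
      using H K by (auto simp: finite_index_subgroups_def)
    let ?J = "generate G (H \<union> K)"
    have HK: "H \<union> K \<subseteq> carrier G"
      using sub subgroup.subset by blast
    have J: "subgroup ?J G" "H \<union> K \<subseteq> ?J"
      by (rule generate_is_subgroup[OF HK], rule subsetI, rule generate.incl)
    moreover have "finite_index G ?J"
      using finite_index_supergroup[OF sub(1) fin J(1)] J(2) by simp
    moreover have "?J \<subseteq> U" if "subgroup U G" "H \<union> K \<subseteq> U" for U
      using generate_subgroup_incl[OF that(2,1)] .
    ultimately have "least ?L ?J (Upper ?L {H, K})"
      using H K by (intro least_UpperI) (auto simp: Upper_def finite_index_subgroups_def)
    then show ?thesis ..
  qed
  have meet: "\<exists>s. greatest ?L s (Lower ?L {H, K})"
    if H: "H \<in> carrier ?L" and K: "K \<in> carrier ?L" for H K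
  proof -
    have "subgroup (H \<inter> K) G" "finite_index G (H \<inter> K)"
      using H K by (auto simp: finite_index_subgroups_def
          intro: subgroups_Inter_pair finite_index_Int)
    then have "greatest ?L (H \<inter> K) (Lower ?L {H, K})"
      using H K by (intro greatest_LowerI) (auto simp: Lower_def finite_index_subgroups_def)
    then show ?thesis ..
  qed
  interpret partial_order ?L by (rule po)
  show ?thesis
    by unfold_locales (fact join, fact meet)
qed

lemma (in group) principal_dual_order_ideal_finite_index_subgroups:
  assumes "H \<in> carrier (finite_index_subgroups G)"
  shows "principal_dual_order_ideal (finite_index_subgroups G) H = {K. subgroup K G \<and> H \<subseteq> K}"
  using assms finite_index_supergroup
  by (auto simp: principal_dual_order_ideal_def finite_index_subgroups_def)

lemma locally_finite_if_finite_principal_dual_order_ideals: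
  assumes "\<And>t. t \<in> carrier P \<Longrightarrow> finite (principal_dual_order_ideal P t)"
  shows "locally_finite P"
  unfolding locally_finite_def
proof (intro ballI impI)
  fix s t assume "s \<in> carrier P"
  moreover have "\<lbrace>s..t\<rbrace>\<^bsub>P\<^esub> \<subseteq> principal_dual_order_ideal P s"
    by (auto simp: at_least_at_most_def principal_dual_order_ideal_def)
  ultimately show "finite \<lbrace>s..t\<rbrace>\<^bsub>P\<^esub>"
    using assms finite_subset by blast
qed

theorem lemma2:
  fixes G :: "('a, 'b) monoid_scheme"
  assumes "group G"
  shows "lattice (finite_index_subgroups G) \<and>
    (finitely_generated_group G \<longrightarrow>
      (\<forall>H \<in> carrier (finite_index_subgroups G).
         principal_dual_order_ideal (finite_index_subgroups G) H = {K. subgroup K G \<and> H \<subseteq> K} \<and>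
         finite (principal_dual_order_ideal (finite_index_subgroups G) H)) \<and>
      lattice (finite_index_subgroups G) \<and> locally_finite (finite_index_subgroups G))"
proof -
  interpret group G by (rule assms)
  have finite: "finite (principal_dual_order_ideal (finite_index_subgroups G) H)"
    if H: "H \<in> carrier (finite_index_subgroups G)" for H
    unfolding principal_dual_order_ideal_finite_index_subgroups[OF H]
    using H finite_supergroups by (simp add: finite_index_subgroups_def)
  moreover have "locally_finite (finite_index_subgroups G)"
    by (rule locally_finite_if_finite_principal_dual_order_ideals) (rule finite)
  ultimately show ?thesis
    using lattice_finite_index_subgroups principal_dual_order_ideal_finite_index_subgroups
    by simp
qed

end
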